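(* The spaces $C_{\bar n}\langle\mathbb S^\bullet_\circ\rangle$, $C_{\bar n}\langle\mathbb S^\bullet_\bullet\rangle$ and $C_{\bar n}\langle\mathbb S^\circ_\circ\rangle$ have the same cellulation as the toroidal Coxeter complexes $\mathbb T\mathcal C\widetilde B_n$, $\mathbb T\mathcal C\widetilde C_n$ and $\mathbb T\mathcal C\widetilde D_n$ respectively.
   Context: Let $\mathbb S=\mathbb R/2\mathbb Z$ be the circle with the reflection $x\mapsto -x$, whose two fixed points (the points on the axis of symmetry) are $0$ and $1$, and let $\mathbb T^n=\mathbb S^n$. Define $C_{\bar n}(\mathbb S^\bullet_\circ)=\mathbb T^n\setminus\{(x_1,\dots,x_n):\exists\, i\ne j,\ x_i=\pm x_j,\text{ or }\exists\, i,\ x_i=1\}$ (pairs of symmetric labeled particles with a fixed particle at $1$); $C_{\bar n}(\mathbb S^\bullet_\bullet)=\mathbb T^n\setminus\{(x_1,\dots,x_n):\exists\, i\neq j,\ x_i=\pm x_j,\text{ or }\exists\, i,\ x_i=1\text{ or }x_i=0\}$ (fixed particles at $0$ and $1$); $C_{\bar n}(\mathbb S^\circ_\circ)=\mathbb T^n\setminus\{(x_1,\dots,x_n):\exists\, i\neq j,\ x_i=\pm x_j\}$ (no fixed particles). $C_{\bar n}\langle\cdot\rangle$ denotes the corresponding space in which particles are allowed to collide (the removed hyperplanes are put back), cellulated by the loci of collisions. The toroidal Coxeter complex $\mathbb T\mathcal C W$ is the quotient by the translations $(2\mathbb Z)^n$ of $\mathbb R^n$ cellulated by the following affine hyperplanes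 ($i\neq j$, $k\in2\mathbb Z$): for $\widetilde B_n$: $x_i=\pm x_j+k$, $x_i=1+k$; for $\widetilde C_n$: $x_i=\pm x_j+k$, $x_i=1+k$, $x_i=0+k$; for $\widetilde D_n$: $x_i=\pm x_j+k$. *)

theory Defs
  imports "HOL-Analysis.Analysis"
begin

section \<open>The circle and the two tori\<close>

definition circle_rel :: "real \<Rightarrow> real \<Rightarrow> bool" where
  "circle_rel s t \<longleftrightarrow> (\<exists>k::int. s - t = 2 * of_int k)"

lemma equivp_circle_rel: "equivp circle_rel"
proof (rule equivpI)
  show "reflp circle_rel"
    by (rule reflpI) (auto simp: circle_rel_def intro: exI[of _ 0])
  show "symp circle_rel"
  proof (rule sympI)
    fix s t assume "circle_rel s t"
    then obtain k :: int where "s - t = 2 * of_int k" by (auto simp: circle_rel_def)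
    then have "t - s = 2 * of_int (- k)" by simp
    then show "circle_rel t s" unfolding circle_rel_def by blast
  qed
  show "transp circle_rel"
  proof (rule transpI)
    fix s t u assume "circle_rel s t" "circle_rel t u"
    then obtain k l :: int where "s - t = 2 * of_int k" "t - u = 2 * of_int l"
      by (auto simp: circle_rel_def)
    then have "s - u = 2 * of_int (k + l)" by simp
    then show "circle_rel s u" unfolding circle_rel_def by blast
  qed
qed

quotient_type circle = real / circle_rel
  by (rule equivp_circle_rel)

instantiation circle :: "{zero, one, uminus}"
begin

lift_definition zero_circle :: circle is "0 :: real" .

lift_definition one_circle :: circle is "1 :: real" .

lift_definition uminus_circle :: "circle \<Rightarrow> circle" is "uminus :: real \<Rightarrow> real"
proof -
  fix s t assume "circle_rel s t"
  then obtain k :: int where "s - t = 2 * of_int k" by (auto simp: circle_rel_def)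
  then have "- s - - t = 2 * of_int (- k)" by simp
  then show "circle_rel (- s) (- t)" unfolding circle_rel_def by blast
qed

instance ..

end

instantiation circle :: topological_space
begin

definition open_circle :: "circle set \<Rightarrow> bool" where
  "open U \<longleftrightarrow> open (abs_circle -` U)"

instance
  by standard (auto simp: open_circle_def vimage_Union)

end

text \<open>
  The torus \<open>\<T>\<^sup>n\<close> is \<open>circle ^ 'n\<close> with the product topology.  The toroidal Coxeter
  complexes live instead on the quotient of \<open>real ^ 'n\<close> by translations in \<open>(2\<int>)\<^sup>n\<close>,
  with the quotient topology.
\<close>

definition lattice_rel :: "real ^ 'n \<Rightarrow> real ^ 'n \<Rightarrow> bool" where
  "lattice_rel x y \<longleftrightarrow> (\<exists>k :: 'n \<Rightarrow> int. x - y = (\<chi> i. 2 * of_int (k i)))"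

lemma lattice_rel_iff: "lattice_rel x y \<longleftrightarrow> (\<forall>i. circle_rel (x $ i) (y $ i))"
  unfolding lattice_rel_def circle_rel_def vec_eq_iff by (simp add: choice_iff)

lemma equivp_lattice_rel: "equivp lattice_rel"
  using equivp_circle_rel
  unfolding equivp_reflp_symp_transp reflp_def symp_def transp_def lattice_rel_iff
  by blast

quotient_type (overloaded) 'n translation_torus = "real ^ 'n" / lattice_rel
  by (rule equivp_lattice_rel)

instantiation translation_torus :: (finite) topological_space
begin

definition open_translation_torus :: "'a translation_torus set \<Rightarrow> bool" where
  "open U \<longleftrightarrow> open (abs_translation_torus -` U)"

instance
  by standard (auto simp: open_translation_torus_def vimage_Union)

end

lift_definition torus_of_translation_torus :: "'n::finite translation_torus \<Rightarrow> circle ^ 'n"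
  is "\<lambda>x. \<chi> i. abs_circle (x $ i)"
  by (simp add: lattice_rel_iff vec_eq_iff circle.abs_eq_iff)


section \<open>Cellulated spaces\<close>

text \<open>A subspace of a topological type together with its set of (relatively open) cells.\<close>

type_synonym 'a cellulated = "'a set \<times> 'a set set"

definition same_cellulation_via ::
    "('a::topological_space \<Rightarrow> 'b::topological_space) \<Rightarrow> 'a cellulated \<Rightarrow> 'b cellulated \<Rightarrow> bool"
  where
  "same_cellulation_via f X Y \<longleftrightarrow>
     (\<exists>g. homeomorphism (fst X) (fst Y) f g) \<and> (image f) ` snd X = snd Y"


section \<open>Spaces of symmetric particles\<close>

text \<open>\<open>F\<close> is the set of positions occupied by fixed particles.\<close>

definition config_space :: "circle set \<Rightarrow> (circle ^ 'n) set" where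
  "config_space F =
     UNIV - {x. (\<exists>i j. i \<noteq> j \<and> (x $ i = x $ j \<or> x $ i = - x $ j)) \<or> (\<exists>i. x $ i \<in> F)}"

definition collision_loci :: "circle set \<Rightarrow> (circle ^ 'n) set set" where
  "collision_loci F =
     {{x. x $ i = x $ j} | i j. i \<noteq> j} \<union>
     {{x. x $ i = - x $ j} | i j. i \<noteq> j} \<union>
     {{x. x $ i = a} | i a. a \<in> F}"

definition collision_space :: "circle set \<Rightarrow> (circle ^ 'n) set" where
  "collision_space F = config_space F \<union> \<Union>(collision_loci F)"

text \<open>The configurations in which exactly the collisions in \<open>\<A>\<close> take place.\<close>

definition collision_stratum ::
    "circle set \<Rightarrow> (circle ^ 'n) set set \<Rightarrow> (circle ^ 'n) set" where
  "collision_stratum F \<A> = (collision_space F \<inter> \<Inter>\<A>) - \<Union>(collision_loci F - \<A>)"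

text \<open>
  A stratum may be disconnected: for instance, \<open>x\<^sub>i = x\<^sub>j = - x\<^sub>j\<close> allows both
  \<open>x\<^sub>j = 0\<close> and \<open>x\<^sub>j = 1\<close>.  Its connected components are the cells; those of the
  stratum without collisions are the components of \<^const>\<open>config_space\<close>.
\<close>

definition collision_cells :: "circle set \<Rightarrow> (circle ^ 'n) set set" where
  "collision_cells F = (\<Union>\<A> \<in> Pow (collision_loci F). components (collision_stratum F \<A>))"

definition collision_complex :: "circle set \<Rightarrow> (circle ^ 'n) cellulated" where
  "collision_complex F = (collision_space F, collision_cells F)"

definition particles_fixed_1 :: "(circle ^ 'n) cellulated" where
  "particles_fixed_1 = collision_complex {1}"

definition particles_fixed_0_1 :: "(circle ^ 'n) cellulated" where
  "particles_fixed_0_1 = collision_complex {0, 1}"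

definition particles_fixed_none :: "(circle ^ 'n) cellulated" where
  "particles_fixed_none = collision_complex {}"


section \<open>Toroidal Coxeter complexes\<close>

text \<open>A pair \<open>(a, b)\<close> stands for the affine hyperplane \<open>{x. a \<bullet> x = b}\<close>.\<close>

definition pair_hyperplanes :: "((real ^ 'n) \<times> real) set" where
  "pair_hyperplanes =
     {(axis i 1 - axis j 1, 2 * of_int m) | i j (m::int). i \<noteq> j} \<union>
     {(axis i 1 + axis j 1, 2 * of_int m) | i j (m::int). i \<noteq> j}"

definition point_hyperplanes :: "real \<Rightarrow> ((real ^ 'n) \<times> real) set" where
  "point_hyperplanes c = {(axis i 1, c + 2 * of_int m) | i (m::int). True}"

definition affine_B :: "((real ^ 'n) \<times> real) set" where
  "affine_B = pair_hyperplanes \<union> point_hyperplanes 1"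

definition affine_C :: "((real ^ 'n) \<times> real) set" where
  "affine_C = pair_hyperplanes \<union> point_hyperplanes 1 \<union> point_hyperplanes 0"

definition affine_D :: "((real ^ 'n) \<times> real) set" where
  "affine_D = pair_hyperplanes"

lemma pair_hyperplane_minus_iff:
  "(axis i 1 - axis j 1) \<bullet> (x :: real ^ 'n) = k \<longleftrightarrow> x $ i = x $ j + k"
  by (auto simp: inner_diff_left inner_axis')

lemma pair_hyperplane_plus_iff:
  "(axis i 1 + axis j 1) \<bullet> (x :: real ^ 'n) = k \<longleftrightarrow> x $ i = - x $ j + k"
  by (auto simp: inner_add_left inner_axis')

lemma point_hyperplane_iff:
  "axis i 1 \<bullet> (x :: real ^ 'n) = k \<longleftrightarrow> x $ i = k"
  by (simp add: inner_axis')

definition hyperplane_side :: "'a::real_inner \<times> real \<Rightarrow> 'a \<Rightarrow> real" where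
  "hyperplane_side h x = sgn (fst h \<bullet> x - snd h)"

text \<open>
  The relatively open faces of all dimensions (not just the chambers): two points share a
  face iff each hyperplane contains both of them or has both strictly on the same side.
\<close>

definition arrangement_faces :: "('a::real_inner \<times> real) set \<Rightarrow> 'a set set" where
  "arrangement_faces H = range (\<lambda>x. {y. \<forall>h\<in>H. hyperplane_side h y = hyperplane_side h x})"

definition toroidal_coxeter_complex ::
    "((real ^ 'n) \<times> real) set \<Rightarrow> ('n::finite) translation_torus cellulated" where
  "toroidal_coxeter_complex H =
     (UNIV, (image abs_translation_torus) ` arrangement_faces H)"

end

theory Submission
  imports Defs
begin

text \<open>
  Both complexes are images of one picture in \<open>\<real>\<^sup>n\<close>.  Write \<open>p\<close> for the covering
  \<open>\<real>\<^sup>n \<rightarrow> \<T>\<^sup>n\<close> that reduces every coordinate mod 2 (\<open>torus_proj\<close> below).  It is a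
  continuous open surjection and factors through the quotient by \<open>(2\<int>)\<^sup>n\<close>, so the induced
  bijection of that quotient with \<open>\<T>\<^sup>n\<close> is a homeomorphism.  It remains to see that \<open>p\<close>
  carries the faces of the affine arrangement onto the cells of the collision space.

  The hyperplanes come in parallel classes \<open>a \<bullet> x = c + 2m\<close>, \<open>m \<in> \<int>\<close>, and \<open>p\<close> maps the union
  of each class onto one collision locus.  After rescaling, the union of a class is the set where the
  affine function \<open>(a \<bullet> x - c) / 2\<close>, called the level of \<open>x\<close>, is an integer.  A face prescribes the
  floor and the ceiling of every level, whereas a collision stratum prescribes only which levels
  are integers.  Within the preimage of a stratum the floors and ceilings are locally constant,
  hence every face is relatively open there, and it is connected because it is convex.  Translations
  in \<open>(2\<int>)\<^sup>n\<close> shift all levels by integers and so permute the faces; consequently the images of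
  two faces are equal or disjoint.  The images of the faces in a stratum thus partition it
  into connected relatively open pieces, and these are its components.
\<close>

section \<open>The covering of the torus\<close>

definition torus_proj :: "real ^ 'n \<Rightarrow> circle ^ 'n" where
  "torus_proj x = (\<chi> i. abs_circle (x $ i))"

lemma torus_of_translation_torus_abs [simp]:
  "torus_of_translation_torus (abs_translation_torus x) = torus_proj x"
  by (simp add: torus_of_translation_torus.abs_eq torus_proj_def)

lemma torus_proj_eq_iff: "torus_proj x = torus_proj y \<longleftrightarrow> lattice_rel x y"
  by (simp add: torus_proj_def vec_eq_iff circle.abs_eq_iff lattice_rel_iff)

lemma surj_torus_proj: "surj torus_proj"
proof (rule surjI)
  fix z :: "circle ^ 'n"
  show "torus_proj (\<chi> i. rep_circle (z $ i)) = z"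
    by (simp add: torus_proj_def vec_eq_iff Quotient3_abs_rep[OF Quotient3_circle])
qed

text \<open>The saturation of an open set is the union of its translates, all of which are open.\<close>

lemma open_abs_circle_image:
  assumes "open U"
  shows "open (abs_circle ` U)"
proof -
  have "abs_circle -` abs_circle ` U = (\<Union>k::int. (\<lambda>t. 2 * of_int k + t) ` U)"
  proof (intro equalityI subsetI)
    fix s assume "s \<in> abs_circle -` abs_circle ` U"
    then obtain t where t: "t \<in> U" "circle_rel s t"
      by (auto simp: circle.abs_eq_iff)
    then obtain k :: int where "s = 2 * of_int k + t"
      by (auto simp: circle_rel_def algebra_simps)
    with t show "s \<in> (\<Union>k::int. (\<lambda>t. 2 * of_int k + t) ` U)" by blast
  next
    fix s assume "s \<in> (\<Union>k::int. (\<lambda>t. 2 * of_int k + t) ` U)"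
    then obtain k :: int and t where t: "t \<in> U" "s = 2 * of_int k + t" by blast
    then have "abs_circle s = abs_circle t"
      by (auto simp: circle.abs_eq_iff circle_rel_def)
    with t show "s \<in> abs_circle -` abs_circle ` U" by blast
  qed
  with assms show ?thesis
    by (auto simp: open_circle_def intro: open_translation)
qed

lemma open_vecD:
  "open S \<Longrightarrow> x \<in> S \<Longrightarrow>
    \<exists>A. (\<forall>i. open (A i) \<and> x $ i \<in> A i) \<and> (\<forall>y. (\<forall>i. y $ i \<in> A i) \<longrightarrow> y \<in> S)"
  unfolding open_vec_def by (rule bspec)

lemma open_torus_proj_vimage:
  fixes V :: "(circle ^ 'n::finite) set"
  assumes "open V"
  shows "open (torus_proj -` V)"
proof -
  have "\<exists>A. (\<forall>i. open (A i) \<and> x $ i \<in> A i) \<and> (\<forall>y. (\<forall>i. y $ i \<in> A i) \<longrightarrow> y \<in> torus_proj -` V)"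
    if "x \<in> torus_proj -` V" for x :: "real ^ 'n"
  proof -
    have "torus_proj x \<in> V" using that by simp
    from open_vecD[OF assms this] obtain B
      where B: "\<forall>i. open (B i) \<and> torus_proj x $ i \<in> B i"
        and sub: "\<forall>y. (\<forall>i. y $ i \<in> B i) \<longrightarrow> y \<in> V"
      by (elim exE conjE) (rule that)
    show ?thesis
    proof (intro exI[of _ "\<lambda>i. abs_circle -` B i"] conjI allI impI)
      show "open (abs_circle -` B i)" for i
        using B by (simp add: open_circle_def)
      show "x $ i \<in> abs_circle -` B i" for i
        using B by (simp add: torus_proj_def)
      show "y \<in> torus_proj -` V" if "\<forall>i. y $ i \<in> abs_circle -` B i" for y
        using that sub by (simp add: torus_proj_def)
    qed
  qed
  then show ?thesis by (simp add: open_vec_def)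
qed

lemma continuous_on_torus_proj: "continuous_on S (torus_proj :: real ^ 'n::finite \<Rightarrow> _)"
  using continuous_on_subset[of UNIV] open_torus_proj_vimage
  by (metis continuous_on_open_vimage Int_UNIV_right open_UNIV subset_UNIV)

lemma open_torus_proj_image:
  fixes U :: "(real ^ 'n::finite) set"
  assumes "open U"
  shows "open (torus_proj ` U)"
proof -
  have "\<exists>B. (\<forall>i. open (B i) \<and> z $ i \<in> B i) \<and> (\<forall>w. (\<forall>i. w $ i \<in> B i) \<longrightarrow> w \<in> torus_proj ` U)"
    if z: "z \<in> torus_proj ` U" for z :: "circle ^ 'n"
  proof -
    obtain x where x: "x \<in> U" "z = torus_proj x" using z by blast
    from open_vecD[OF assms x(1)] obtain A
      where A: "\<forall>i. open (A i) \<and> x $ i \<in> A i"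
        and sub: "\<forall>y. (\<forall>i. y $ i \<in> A i) \<longrightarrow> y \<in> U"
      by (elim exE conjE) (rule that)
    show ?thesis
    proof (intro exI[of _ "\<lambda>i. abs_circle ` A i"] conjI allI impI)
      show "open (abs_circle ` A i)" for i
        using A open_abs_circle_image by blast
      show "z $ i \<in> abs_circle ` A i" for i
        using A by (simp add: x(2) torus_proj_def)
      show "w \<in> torus_proj ` U" if w: "\<forall>i. w $ i \<in> abs_circle ` A i" for w
      proof -
        obtain y where y: "\<And>i. y i \<in> A i" "\<And>i. w $ i = abs_circle (y i)"
          using w unfolding image_iff by metis
        then have "w = torus_proj (\<chi> i. y i)" "(\<chi> i. y i) \<in> U"
          by (auto simp: torus_proj_def vec_eq_iff sub)
        then show ?thesis by blast
      qed
    qed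
  qed
  then show ?thesis by (simp add: open_vec_def)
qed

lemma surj_abs_translation_torus: "surj (abs_translation_torus :: real ^ 'n::finite \<Rightarrow> _)"
  by (rule surjI[of _ rep_translation_torus])
     (rule Quotient3_abs_rep[OF Quotient3_translation_torus])

lemma bij_torus_of_translation_torus:
  "bij (torus_of_translation_torus :: 'n::finite translation_torus \<Rightarrow> circle ^ 'n)"
proof (rule bijI)
  show "inj (torus_of_translation_torus :: 'n translation_torus \<Rightarrow> _)"
  proof (rule injI)
    fix u v :: "'n translation_torus"
    assume "torus_of_translation_torus u = torus_of_translation_torus v"
    moreover obtain x y where "u = abs_translation_torus x" "v = abs_translation_torus y"
      using surj_abs_translation_torus by (metis surjD)
    ultimately show "u = v"
      by (simp add: torus_proj_eq_iff translation_torus.abs_eq_iff)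
  qed
  show "surj (torus_of_translation_torus :: 'n translation_torus \<Rightarrow> _)"
    using surj_torus_proj by (metis surj_def torus_of_translation_torus_abs)
qed

text \<open>
  A subset of the quotient is open iff its preimage in \<open>\<real>\<^sup>n\<close> is, so continuity and openness of
  the comparison map are continuity and openness of the covering.
\<close>

lemma homeomorphism_torus_of_translation_torus:
  "\<exists>g. homeomorphism (UNIV :: 'n::finite translation_torus set) (UNIV :: (circle ^ 'n) set)
         torus_of_translation_torus g"
proof -
  let ?f = "torus_of_translation_torus :: 'n translation_torus \<Rightarrow> circle ^ 'n"
  have vimage: "open (?f -` V)" if "open V" for V
  proof -
    have "abs_translation_torus -` ?f -` V = torus_proj -` V" by auto
    then show ?thesis
      using open_torus_proj_vimage[OF that] by (simp add: open_translation_torus_def)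
  qed
  have image: "open (?f ` U)" if "open U" for U
  proof -
    have "?f ` U = torus_proj ` (abs_translation_torus -` U)"
    proof -
      have "U = abs_translation_torus ` (abs_translation_torus -` U)"
        by (rule surj_image_vimage_eq[OF surj_abs_translation_torus, symmetric])
      then have "?f ` U = ?f ` abs_translation_torus ` (abs_translation_torus -` U)"
        by simp
      then show ?thesis unfolding image_image by simp
    qed
    then show ?thesis
      using that open_torus_proj_image by (simp add: open_translation_torus_def)
  qed
  have "continuous_on UNIV ?f"
    using vimage by (simp add: continuous_on_open_vimage)
  moreover have "continuous_on UNIV (inv ?f)"
    using image bij_torus_of_translation_torus[where 'n = 'n]
    by (simp add: continuous_on_open_vimage bij_vimage_eq_inv_image bij_imp_bij_inv inv_inv_eq)
  ultimately have "homeomorphism UNIV UNIV ?f (inv ?f)"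
    using bij_torus_of_translation_torus[where 'n = 'n]
    by (auto simp: homeomorphism_def bij_is_surj bij_is_inj surj_f_inv_f bij_imp_bij_inv)
  then show ?thesis by blast
qed


section \<open>Components from a partition into open connected pieces\<close>

lemma connected_component_set_eq_clopen:
  assumes "openin (top_of_set S) C" "openin (top_of_set S) (S - C)" "connected C" "z \<in> C"
  shows "connected_component_set S z = C"
proof (rule antisym)
  have CS: "C \<subseteq> S" using assms(1) openin_imp_subset by blast
  show "C \<subseteq> connected_component_set S z"
    using assms CS by (simp add: connected_component_maximal)
  let ?K = "connected_component_set S z"
  have K: "connected ?K" "?K \<subseteq> S" "z \<in> ?K"
    using CS assms(4) by (auto simp: connected_connected_component
      connected_component_subset connected_component_refl)
  obtain U V where U: "open U" "C = S \<inter> U" and V: "open V" "S - C = S \<inter> V"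
    using assms(1,2) by (auto simp: openin_open)
  show "?K \<subseteq> C"
  proof (rule ccontr)
    assume "\<not> ?K \<subseteq> C"
    then have "V \<inter> ?K \<noteq> {}" using K(2) V(2) by blast
    moreover have "U \<inter> ?K \<noteq> {}" using K(3) U(2) assms(4) by blast
    moreover have "U \<inter> V \<inter> ?K = {}" "?K \<subseteq> U \<union> V" using K(2) U(2) V(2) by blast+
    ultimately show False using K(1) U(1) V(1) unfolding connected_def by blast
  qed
qed

lemma components_eq_open_partition:
  assumes opn: "\<And>C. C \<in> \<C> \<Longrightarrow> openin (top_of_set S) C"
    and conn: "\<And>C. C \<in> \<C> \<Longrightarrow> connected C"
    and ne: "{} \<notin> \<C>"
    and cover: "\<Union>\<C> = S"
    and disj: "\<And>C D. \<lbrakk>C \<in> \<C>; D \<in> \<C>; C \<inter> D \<noteq> {}\<rbrakk> \<Longrightarrow> C = D"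
  shows "components S = \<C>"
proof -
  have comp: "connected_component_set S z = C" if "C \<in> \<C>" "z \<in> C" for C z
  proof (rule connected_component_set_eq_clopen)
    have "S - C = \<Union>(\<C> - {C})" using cover disj that(1) by blast
    then show "openin (top_of_set S) (S - C)" using opn by auto
  qed (use that opn conn in auto)
  show ?thesis
  proof (intro equalityI subsetI)
    fix K assume "K \<in> components S"
    then obtain z where "z \<in> S" "K = connected_component_set S z"
      by (auto simp: components_def)
    then show "K \<in> \<C>" using cover comp by (metis UnionE)
  next
    fix C assume C: "C \<in> \<C>"
    then obtain z where "z \<in> C" using ne by (metis ex_in_conv)
    then show "C \<in> components S" using comp[OF C] C cover by (auto simp: components_def)
  qed
qed


section \<open>Faces of a family of parallel classes of hyperplanes\<close>

text \<open>
  The pair \<open>r = (a, c)\<close> stands for the parallel class of the hyperplanes \<open>a \<bullet> x = c + 2m\<close>,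
  on which the level of \<open>x\<close> takes the value \<open>m\<close>.
\<close>

definition level :: "'a::real_inner \<times> real \<Rightarrow> 'a \<Rightarrow> real" where
  "level r x = (fst r \<bullet> x - snd r) / 2"

definition parallel_classes :: "('a::real_inner \<times> real) set \<Rightarrow> ('a \<times> real) set" where
  "parallel_classes R = {(fst r, snd r + 2 * of_int m) | r (m::int). r \<in> R}"

definition locus :: "(real ^ 'n) \<times> real \<Rightarrow> (circle ^ 'n) set" where
  "locus r = torus_proj ` {x. level r x \<in> \<int>}"

definition face :: "('a::real_inner \<times> real) set \<Rightarrow> 'a \<Rightarrow> 'a set" where
  "face R x = {y. \<forall>r\<in>R. \<lfloor>level r y\<rfloor> = \<lfloor>level r x\<rfloor> \<and> \<lceil>level r y\<rceil> = \<lceil>level r x\<rceil>}"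

text \<open>The preimage of the collision stratum of \<open>torus_proj x\<close>, when the loci are those of \<open>R\<close>.\<close>

definition pattern :: "((real ^ 'n) \<times> real) set \<Rightarrow> real ^ 'n \<Rightarrow> (real ^ 'n) set" where
  "pattern R x = {y. \<forall>r\<in>R. level r y \<in> \<int> \<longleftrightarrow> level r x \<in> \<int>}"

lemma hyperplane_side_level:
  "hyperplane_side (fst r, snd r + 2 * of_int m) x = sgn (level r x - of_int m)"
  by (auto simp: hyperplane_side_def level_def sgn_if field_simps)

lemma sgn_diff_int_eq_iff:
  fixes s t :: real
  shows "(\<forall>m::int. sgn (s - of_int m) = sgn (t - of_int m)) \<longleftrightarrow> \<lfloor>s\<rfloor> = \<lfloor>t\<rfloor> \<and> \<lceil>s\<rceil> = \<lceil>t\<rceil>"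
proof
  have ge: "of_int m \<le> u \<longleftrightarrow> 0 \<le> sgn (u - of_int m)"
    and le: "u \<le> of_int m \<longleftrightarrow> sgn (u - of_int m) \<le> 0" for m :: int and u :: real
    by (auto simp: sgn_if)
  assume "\<forall>m::int. sgn (s - of_int m) = sgn (t - of_int m)"
  then have "of_int m \<le> s \<longleftrightarrow> of_int m \<le> t" "s \<le> of_int m \<longleftrightarrow> t \<le> of_int m" for m :: int
    unfolding ge le by simp_all
  then show "\<lfloor>s\<rfloor> = \<lfloor>t\<rfloor> \<and> \<lceil>s\<rceil> = \<lceil>t\<rceil>"
    by (meson antisym ceiling_le_iff le_floor_iff order_refl)
next
  have sgn: "sgn (u - of_int m) = (if m \<le> \<lfloor>u\<rfloor> then if \<lceil>u\<rceil> \<le> m then 0 else 1 else - 1)"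
    for m :: int and u :: real
    unfolding le_floor_iff ceiling_le_iff by (auto simp: sgn_if)
  assume "\<lfloor>s\<rfloor> = \<lfloor>t\<rfloor> \<and> \<lceil>s\<rceil> = \<lceil>t\<rceil>"
  then show "\<forall>m::int. sgn (s - of_int m) = sgn (t - of_int m)"
    by (simp add: sgn)
qed

lemma arrangement_faces_parallel_classes:
  "arrangement_faces (parallel_classes R) = range (face R)"
proof -
  have "{y. \<forall>h\<in>parallel_classes R. hyperplane_side h y = hyperplane_side h x} = face R x" for x
  proof -
    have "(\<forall>h\<in>parallel_classes R. hyperplane_side h y = hyperplane_side h x) \<longleftrightarrow>
        (\<forall>r\<in>R. \<forall>m::int. sgn (level r y - of_int m) = sgn (level r x - of_int m))" for y
      unfolding parallel_classes_def hyperplane_side_level[symmetric] by blast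
    then show ?thesis by (simp only: sgn_diff_int_eq_iff face_def)
  qed
  then show ?thesis by (simp add: arrangement_faces_def)
qed

lemma mem_face: "x \<in> face R x"
  by (simp add: face_def)

lemma face_eq: "y \<in> face R x \<Longrightarrow> face R y = face R x"
  by (auto simp: face_def)

lemma Ints_iff_floor_eq_ceiling: "t \<in> \<int> \<longleftrightarrow> \<lfloor>t\<rfloor> = \<lceil>t\<rceil>" for t :: real
  by (metis Ints_cases Ints_of_int ceiling_of_int floor_of_int
      of_int_floor_le le_of_int_ceiling antisym)

lemma face_subset_pattern: "face R x \<subseteq> pattern R x"
  by (auto simp: face_def pattern_def Ints_iff_floor_eq_ceiling)

lemma continuous_on_level: "continuous_on S (level r)"
  unfolding level_def by (intro continuous_intros) simp

text \<open>
  The floor and the ceiling of an affine function cut out a half-open interval each, so a face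
  is an intersection of half-spaces.
\<close>

lemma convex_face: "convex (face R x)"
proof -
  have halfspaces: "face R x = (\<Inter>r\<in>R.
      {y. fst r \<bullet> y \<ge> 2 * of_int \<lfloor>level r x\<rfloor> + snd r}
    \<inter> {y. fst r \<bullet> y < 2 * (of_int \<lfloor>level r x\<rfloor> + 1) + snd r}
    \<inter> {y. fst r \<bullet> y > 2 * (of_int \<lceil>level r x\<rceil> - 1) + snd r}
    \<inter> {y. fst r \<bullet> y \<le> 2 * of_int \<lceil>level r x\<rceil> + snd r})"
    unfolding face_def floor_eq_iff ceiling_eq_iff by (auto simp: level_def field_simps)
  show ?thesis
    unfolding halfspaces
    by (intro convex_INT convex_Int convex_halfspace_ge convex_halfspace_lt
        convex_halfspace_gt convex_halfspace_le)
qed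

text \<open>
  The open set consists of the points all of whose levels lie strictly between \<open>\<lceil>t\<rceil> - 1\<close> and
  \<open>\<lfloor>t\<rfloor> + 1\<close>, where \<open>t\<close> is the corresponding level of \<open>x\<close>.  If \<open>t\<close> is an integer, then it is
  the only integer in this interval; otherwise the interval is the one between the neighbouring
  integers.  Finiteness of the family makes the intersection open.
\<close>

lemma face_eq_pattern_Int_open:
  fixes R :: "((real ^ 'n::finite) \<times> real) set"
  assumes "finite R"
  obtains U where "open U" "face R x = pattern R x \<inter> U"
proof -
  let ?I = "\<lambda>r. {of_int \<lceil>level r x\<rceil> - 1 <..< of_int \<lfloor>level r x\<rfloor> + 1 :: real}"
  let ?U = "\<Inter>r\<in>R. level r -` ?I r"
  have "open ?U"
    using assms by (intro open_INT ballI)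
      (auto intro!: open_vimage simp: continuous_on_level)
  moreover have "face R x = pattern R x \<inter> ?U"
  proof -
    have eq: "\<lfloor>s\<rfloor> = \<lfloor>t\<rfloor> \<and> \<lceil>s\<rceil> = \<lceil>t\<rceil> \<longleftrightarrow>
        (s \<in> \<int> \<longleftrightarrow> t \<in> \<int>) \<and> s \<in> {of_int \<lceil>t\<rceil> - 1 <..< of_int \<lfloor>t\<rfloor> + 1}" for s t :: real
      unfolding Ints_iff_floor_eq_ceiling greaterThanLessThan_iff by linarith
    show ?thesis unfolding face_def pattern_def eq by auto
  qed
  ultimately show ?thesis by (rule that)
qed


section \<open>Faces and strata on the torus\<close>

text \<open>
  Integrality of the shift is what makes a locus a well-defined condition on the torus and
  lets translations permute the faces.
\<close>

locale periodic_family =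
  fixes R :: "((real ^ 'n::finite) \<times> real) set"
  assumes finite_family: "finite R"
    and level_shift: "\<lbrakk>r \<in> R; lattice_rel x 0\<rbrakk> \<Longrightarrow> fst r \<bullet> x / 2 \<in> \<int>"
begin

lemma level_translate:
  assumes "r \<in> R" "torus_proj x = torus_proj y"
  shows "\<exists>m::int. \<forall>z. level r (z + (y - x)) = level r z + of_int m"
proof -
  have "lattice_rel (y - x) 0"
    using assms(2)[symmetric] by (simp add: torus_proj_eq_iff lattice_rel_def)
  from level_shift[OF assms(1) this] obtain m :: int where "fst r \<bullet> (y - x) / 2 = of_int m"
    by (auto elim: Ints_cases)
  then show ?thesis
    by (intro exI[of _ m] allI) (simp add: level_def inner_add_right diff_divide_distrib add_divide_distrib)
qed

lemma torus_proj_mem_locus_iff: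
  assumes "r \<in> R"
  shows "torus_proj x \<in> locus r \<longleftrightarrow> level r x \<in> \<int>"
proof
  assume "torus_proj x \<in> locus r"
  then obtain y where y: "torus_proj y = torus_proj x" "level r y \<in> \<int>"
    by (auto simp: locus_def)
  obtain m :: int where "\<forall>z. level r (z + (x - y)) = level r z + of_int m"
    using level_translate[OF assms y(1)] by blast
  from this[rule_format, of y] have "level r x = level r y + of_int m" by simp
  with y(2) show "level r x \<in> \<int>" by simp
qed (auto simp: locus_def)

text \<open>
  Translation by \<open>y - x\<close> adds the same integer to a level at every point, so points whose floors
  and ceilings agree are moved to points whose floors and ceilings agree.
\<close>

lemma torus_proj_image_face_subset:
  assumes "torus_proj x = torus_proj y"
  shows "torus_proj ` face R x \<subseteq> torus_proj ` face R y"
proof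
  fix z assume "z \<in> torus_proj ` face R x"
  then obtain w where w: "w \<in> face R x" "z = torus_proj w" by blast
  have "w + (y - x) \<in> face R y"
    unfolding face_def
  proof (intro CollectI ballI)
    fix r assume r: "r \<in> R"
    obtain m :: int where shift: "\<And>v. level r (v + (y - x)) = level r v + of_int m"
      using level_translate[OF r assms] by blast
    have "\<lfloor>level r w\<rfloor> = \<lfloor>level r x\<rfloor>" "\<lceil>level r w\<rceil> = \<lceil>level r x\<rceil>"
      using w(1) r by (auto simp: face_def)
    then show "\<lfloor>level r (w + (y - x))\<rfloor> = \<lfloor>level r y\<rfloor> \<and> \<lceil>level r (w + (y - x))\<rceil> = \<lceil>level r y\<rceil>"
      using shift[of w] shift[of x] by simp
  qed
  moreover have "torus_proj (w + (y - x)) = z"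
    using assms[symmetric] by (simp add: w(2) torus_proj_eq_iff lattice_rel_def)
  ultimately show "z \<in> torus_proj ` face R y" by blast
qed

lemma torus_proj_image_faces_eq:
  assumes "torus_proj ` face R x \<inter> torus_proj ` face R y \<noteq> {}"
  shows "torus_proj ` face R x = torus_proj ` face R y"
proof -
  obtain u v where uv: "u \<in> face R x" "v \<in> face R y" "torus_proj u = torus_proj v"
    using assms by fastforce
  then have "torus_proj ` face R u = torus_proj ` face R v"
    using torus_proj_image_face_subset by (metis antisym)
  with uv show ?thesis by (simp add: face_eq)
qed

text \<open>
  Patterns are invariant under translations; therefore the image of a relatively open subset
  of a pattern is relatively open in the image of the pattern.
\<close>

lemma components_image_pattern:
  "components (torus_proj ` pattern R x) = (\<lambda>y. torus_proj ` face R y) ` pattern R x"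
proof (rule components_eq_open_partition)
  let ?S = "torus_proj ` pattern R x" and ?\<C> = "(\<lambda>y. torus_proj ` face R y) ` pattern R x"
  have same: "pattern R y = pattern R x" if "y \<in> pattern R x" for y
    using that by (auto simp: pattern_def)
  have saturated: "v \<in> pattern R x" if "u \<in> pattern R x" "torus_proj u = torus_proj v" for u v
    using that by (simp add: pattern_def flip: torus_proj_mem_locus_iff)
  show "openin (top_of_set ?S) C" if "C \<in> ?\<C>" for C
  proof -
    obtain y where y: "y \<in> pattern R x" "C = torus_proj ` face R y" using \<open>C \<in> ?\<C>\<close> by blast
    obtain U where U: "open U" "face R y = pattern R x \<inter> U"
      using face_eq_pattern_Int_open[OF finite_family, of y] same[OF y(1)] by metis
    have "C = ?S \<inter> torus_proj ` U"
      unfolding y(2) U(2) using saturated by (fastforce simp: image_iff)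
    then show ?thesis
      using open_torus_proj_image[OF U(1)] by (auto simp: openin_open)
  qed
  show "connected C" if "C \<in> ?\<C>" for C
    using that by (auto intro!: connected_continuous_image continuous_on_torus_proj
        convex_connected convex_face)
  show "{} \<notin> ?\<C>" using mem_face by fastforce
  show "\<Union>?\<C> = ?S"
    using mem_face face_subset_pattern same by fastforce
  show "C = D" if "C \<in> ?\<C>" "D \<in> ?\<C>" "C \<inter> D \<noteq> {}" for C D
    using that torus_proj_image_faces_eq by blast
qed

end


section \<open>Collision spaces of symmetric particles\<close>

lemma collision_space_eq_UNIV: "(collision_space F :: (circle ^ 'n) set) = UNIV"
proof -
  have Union_Collect: "\<Union>{A i j | i j. Q i j} = {x. \<exists>i j. Q i j \<and> x \<in> A i j}"
    for A :: "'i \<Rightarrow> 'j \<Rightarrow> 'x set" and Q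
    by blast
  have "(\<Union>(collision_loci F) :: (circle ^ 'n) set) =
      {x. (\<exists>i j. i \<noteq> j \<and> (x $ i = x $ j \<or> x $ i = - x $ j)) \<or> (\<exists>i. x $ i \<in> F)}"
    unfolding collision_loci_def Union_Un_distrib Union_Collect by auto
  then show ?thesis by (simp add: collision_space_def config_space_def)
qed

text \<open>Written as a fibre of the incidence map, a stratum is easy to pull back along the covering.\<close>

lemma collision_stratum_eq:
  assumes "\<A> \<subseteq> collision_loci F"
  shows "collision_stratum F \<A> = {z. {L \<in> collision_loci F. z \<in> L} = \<A>}"
proof -
  have "{L \<in> \<L>. P L} = \<A> \<longleftrightarrow> (\<forall>L\<in>\<A>. P L) \<and> (\<forall>L\<in>\<L> - \<A>. \<not> P L)" if "\<A> \<subseteq> \<L>" for \<L> P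
    using that by blast
  from this[OF assms] show ?thesis
    by (simp add: collision_stratum_def collision_space_eq_UNIV set_eq_iff)
qed

text \<open>
  Since the loci are the images of the parallel classes, two points of \<open>\<real>\<^sup>n\<close> project to the same
  stratum iff the same levels are integers at both, that is, iff they have the same pattern.
\<close>

lemma (in periodic_family) torus_proj_image_faces_eq_collision_cells:
  assumes loci: "collision_loci F = locus ` R"
  shows "range (\<lambda>x. torus_proj ` face R x) = collision_cells F"
proof -
  let ?inc = "\<lambda>z :: circle ^ 'n. {L \<in> collision_loci F. z \<in> L}"
  have inc_iff: "?inc (torus_proj y) = ?inc (torus_proj x) \<longleftrightarrow> y \<in> pattern R x" for x y
  proof -
    have "?inc (torus_proj y) = ?inc (torus_proj x) \<longleftrightarrow>
        (\<forall>L\<in>collision_loci F. torus_proj y \<in> L \<longleftrightarrow> torus_proj x \<in> L)"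
      by (auto simp only: set_eq_iff mem_Collect_eq)
    then show ?thesis by (simp add: loci torus_proj_mem_locus_iff pattern_def)
  qed
  have stratum: "collision_stratum F (?inc (torus_proj x)) = torus_proj ` pattern R x" for x
  proof -
    have "collision_stratum F (?inc (torus_proj x)) = {z. ?inc z = ?inc (torus_proj x)}"
      by (rule collision_stratum_eq) blast
    also have "\<dots> = torus_proj ` {y. ?inc (torus_proj y) = ?inc (torus_proj x)}"
      using surj_image_vimage_eq[OF surj_torus_proj, of "{z. ?inc z = ?inc (torus_proj x)}"]
      unfolding vimage_Collect_eq by (rule sym)
    also have "\<dots> = torus_proj ` pattern R x"
      unfolding inc_iff by simp
    finally show ?thesis .
  qed
  show ?thesis
  proof (intro equalityI subsetI)
    fix C :: "(circle ^ 'n) set" assume "C \<in> range (\<lambda>x. torus_proj ` face R x)"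
    then obtain x where "C = torus_proj ` face R x" by blast
    then have "C \<in> components (collision_stratum F (?inc (torus_proj x)))"
      unfolding stratum components_image_pattern
      by (intro image_eqI[of _ _ x]) (simp_all add: pattern_def)
    then show "C \<in> collision_cells F"
      unfolding collision_cells_def by (rule UN_I[rotated]) blast
  next
    fix C :: "(circle ^ 'n) set" assume "C \<in> collision_cells F"
    then obtain \<A> where \<A>: "\<A> \<subseteq> collision_loci F" "C \<in> components (collision_stratum F \<A>)"
      unfolding collision_cells_def by (elim UN_E) (rule that[OF PowD])
    have "collision_stratum F \<A> \<noteq> {}"
      using \<A>(2) by (metis components_empty empty_iff)
    then obtain z where "z \<in> collision_stratum F \<A>" by blast
    moreover obtain x where "z = torus_proj x" using surj_torus_proj by (metis surjD)
    \<comment> \<open>The index set of a nonempty stratum is the incidence set of any of its points.\<close>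
    ultimately have "?inc (torus_proj x) = \<A>"
      unfolding collision_stratum_eq[OF \<A>(1)] by simp
    then have "C \<in> components (torus_proj ` pattern R x)"
      using \<A>(2) stratum[of x] by simp
    then show "C \<in> range (\<lambda>x. torus_proj ` face R x)"
      unfolding components_image_pattern by blast
  qed
qed


section \<open>The collision family\<close>

text \<open>
  The three cases differ only in the set \<open>F\<close> of points on the axis of symmetry that carry fixed
  particles, here given by representatives in \<open>\<real>\<close>.
\<close>

definition collision_family :: "real set \<Rightarrow> ((real ^ 'n) \<times> real) set" where
  "collision_family F =
     {(axis i 1 - axis j 1, 0) | i j. i \<noteq> j} \<union>
     {(axis i 1 + axis j 1, 0) | i j. i \<noteq> j} \<union>
     {(axis i 1, c) | i c. c \<in> F}"

lemma parallel_classes_Un: "parallel_classes (R \<union> S) = parallel_classes R \<union> parallel_classes S"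
  unfolding parallel_classes_def by blast

lemma parallel_classes_Collect:
  "parallel_classes {h i j | i j. P i j} =
    {(fst (h i j), snd (h i j) + 2 * of_int m) | i j (m::int). P i j}"
  unfolding parallel_classes_def by blast

lemma parallel_classes_collision_family:
  "parallel_classes (collision_family F :: ((real ^ 'n) \<times> real) set) =
    pair_hyperplanes \<union> (\<Union>c\<in>F. point_hyperplanes c)"
proof -
  have "{(axis i 1, c + 2 * of_int m) | i c (m::int). c \<in> F} =
      (\<Union>c\<in>F. point_hyperplanes c :: ((real ^ 'n) \<times> real) set)"
    unfolding point_hyperplanes_def by blast
  then show ?thesis
    unfolding collision_family_def parallel_classes_Un parallel_classes_Collect pair_hyperplanes_def
    by simp
qed

lemma finite_collision_family:
  assumes "finite F"
  shows "finite (collision_family F :: ((real ^ 'n::finite) \<times> real) set)"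
proof -
  have "collision_family F \<subseteq> (\<lambda>(i, j). (axis i 1 - axis j 1, 0)) ` UNIV
      \<union> (\<lambda>(i, j). (axis i 1 + axis j 1, 0)) ` UNIV
      \<union> (\<lambda>(i, c). (axis i 1, c)) ` ((UNIV :: 'n set) \<times> F)"
    unfolding collision_family_def by fastforce
  then show ?thesis by (rule finite_subset) (use assms in simp)
qed

lemma periodic_collision_family:
  assumes "finite F"
  shows "periodic_family (collision_family F :: ((real ^ 'n::finite) \<times> real) set)"
proof
  show "finite (collision_family F :: ((real ^ 'n) \<times> real) set)"
    using assms by (rule finite_collision_family)
  fix r :: "(real ^ 'n) \<times> real" and x :: "real ^ 'n"
  assume r: "r \<in> collision_family F" and "lattice_rel x 0"
  then obtain k :: "'n \<Rightarrow> int" where "x - 0 = (\<chi> i. 2 * of_int (k i))"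
    unfolding lattice_rel_def by blast
  then have k: "x $ i = 2 * of_int (k i)" for i
    by (simp add: vec_eq_iff)
  show "fst r \<bullet> x / 2 \<in> \<int>"
    using r
    by (auto simp: collision_family_def inner_diff_left inner_add_left inner_axis' k
        diff_divide_distrib add_divide_distrib)
qed

lemma locus_eqI:
  assumes "\<And>x. torus_proj x \<in> L \<longleftrightarrow> level r x \<in> \<int>"
  shows "locus r = L"
proof (intro equalityI subsetI)
  fix z assume "z \<in> locus r"
  then show "z \<in> L" using assms by (auto simp: locus_def)
next
  fix z assume z: "z \<in> L"
  obtain x where x: "z = torus_proj x" using surj_torus_proj by (metis surjD)
  with z show "z \<in> locus r" using assms unfolding locus_def by blast
qed

lemma abs_circle_eq_iff: "abs_circle s = abs_circle t \<longleftrightarrow> (s - t) / 2 \<in> \<int>"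
  by (auto simp: circle.abs_eq_iff circle_rel_def Ints_def field_simps)

lemma locus_diff: "locus (axis i 1 - axis j 1, 0) = {z. z $ i = z $ j}"
  by (rule locus_eqI)
     (simp add: torus_proj_def abs_circle_eq_iff level_def inner_diff_left inner_axis')

lemma locus_add: "locus (axis i 1 + axis j 1, 0) = {z. z $ i = - z $ j}"
  by (rule locus_eqI)
     (simp add: torus_proj_def abs_circle_eq_iff level_def inner_add_left inner_axis'
       uminus_circle.abs_eq)

lemma locus_point: "locus (axis i 1, c) = {z. z $ i = abs_circle c}"
  by (rule locus_eqI)
     (simp add: torus_proj_def abs_circle_eq_iff level_def inner_axis')

lemma collision_loci_eq_locus_image:
  "collision_loci (abs_circle ` F) = locus ` collision_family F"
proof -
  have family: "locus ` collision_family F =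
      {locus (axis i 1 - axis j 1, 0) | i j. i \<noteq> j} \<union>
      {locus (axis i 1 + axis j 1, 0) | i j. i \<noteq> j} \<union>
      {locus (axis i 1, c) | i c. c \<in> F}"
    unfolding collision_family_def by blast
  have points: "{{z. z $ i = a} | i a. a \<in> abs_circle ` F} =
      {{z. z $ i = abs_circle c} | i c. c \<in> F}"
    by blast
  show ?thesis
    unfolding collision_loci_def family locus_diff locus_add locus_point points ..
qed

theorem toroidal_coxeter_complex_same_cellulation_collision_complex:
  assumes "finite F"
  shows "same_cellulation_via torus_of_translation_torus
           (toroidal_coxeter_complex
             (pair_hyperplanes \<union> (\<Union>c\<in>F. point_hyperplanes c) :: ((real ^ 'n::finite) \<times> real) set))
           (collision_complex (abs_circle ` F) :: (circle ^ 'n) cellulated)"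
proof -
  let ?R = "collision_family F :: ((real ^ 'n) \<times> real) set"
  interpret periodic_family ?R using assms by (rule periodic_collision_family)
  have "image torus_of_translation_torus ` image abs_translation_torus `
      arrangement_faces (parallel_classes ?R) = range (\<lambda>x. torus_proj ` face ?R x)"
    by (simp add: arrangement_faces_parallel_classes image_image)
  also have "\<dots> = collision_cells (abs_circle ` F)"
    by (rule torus_proj_image_faces_eq_collision_cells[OF collision_loci_eq_locus_image])
  finally show ?thesis
    unfolding same_cellulation_via_def toroidal_coxeter_complex_def collision_complex_def
      fst_conv snd_conv collision_space_eq_UNIV parallel_classes_collision_family
    using homeomorphism_torus_of_translation_torus by blast
qed

theorem proposition3p10:
  shows "same_cellulation_via torus_of_translation_torus
           (toroidal_coxeter_complex (affine_B :: ((real ^ 'n::finite) \<times> real) set))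
           (particles_fixed_1 :: (circle ^ 'n) cellulated)
       \<and> same_cellulation_via torus_of_translation_torus
           (toroidal_coxeter_complex (affine_C :: ((real ^ 'n) \<times> real) set))
           (particles_fixed_0_1 :: (circle ^ 'n) cellulated)
       \<and> same_cellulation_via torus_of_translation_torus
           (toroidal_coxeter_complex (affine_D :: ((real ^ 'n) \<times> real) set))
           (particles_fixed_none :: (circle ^ 'n) cellulated)"
  using toroidal_coxeter_complex_same_cellulation_collision_complex[of "{1}", where 'n = 'n]
    toroidal_coxeter_complex_same_cellulation_collision_complex[of "{1, 0}", where 'n = 'n]
    toroidal_coxeter_complex_same_cellulation_collision_complex[of "{}", where 'n = 'n]
  by (simp add: affine_B_def affine_C_def affine_D_def particles_fixed_1_def
      particles_fixed_0_1_def particles_fixed_none_def zero_circle_def one_circle_def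
      Un_assoc insert_commute)

end
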